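(* Let $\Omega\subset\mathbb{R}^n$ be a bounded, Lipschitz, open set, $M\in(1,+\infty)$, $m\in[-|\Omega|,|\Omega|]$ and $s\in(0,1)$. Let $\{u_\epsilon\}_\epsilon\subset Z_{M,m}$, with $\epsilon$ ranging over a sequence in $(0,1)$ converging to $0$, be a sequence of minimizers of $\mathcal{F}_\epsilon$ in $\Omega$, that is, $\mathcal{F}_\epsilon(u_\epsilon,\Omega)=\min\{\mathcal{F}_\epsilon(v,\Omega): v\in Z_{M,m}\}$. Then $$\mathcal{F}_\epsilon(u_\epsilon,\Omega)\le C$$ for some positive constant $C$ independent of $\epsilon$.
   Context: Potential: $W:\mathbb{R}\to[0,+\infty)$, $W\in C^2(\mathbb{R})$, $W(\pm1)=0$, $W>0$ in $\mathbb{R}\setminus\{\pm1\}$, $W'(\pm1)=0$, $W''(\pm1)>0$. Space: $Z_{M,m}:=\{u\in L^1_{\rm loc}(\mathbb{R}^n):\|u\|_{L^\infty(\Omega)}\le M,\ \int_\Omega u\,dx=m\}$. Energies ($\Omega^c$ is the complement of $\Omega$ in $\mathbb{R}^n$): $$\mathcal{K}(u,\Omega):=\frac12\int_\Omega\int_\Omega\frac{|u(x)-u(y)|^2}{|x-y|^{n+2s}}dxdy+\int_\Omega\int_{\Omega^c}\frac{|u(x)-u(y)|^2}{|x-y|^{n+2s}}dxdy,$$ $$\mathcal{F}_\epsilon(u,\Omega):=\kappa_\epsilon\Big(\epsilon^{2s}\mathcal{K}(u,\Omega)+\int_\Omega W(u)\,dx\Big),$$ with $\kappa_\epsilon:=\epsilon^{-2s}$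 if $s\in(0,\frac12)$, $\kappa_\epsilon:=|\epsilon\log\epsilon|^{-1}$ if $s=\frac12$, $\kappa_\epsilon:=\epsilon^{-1}$ if $s\in(\frac12,1)$. *)

theory Defs
  imports "HOL-Probability.Essential_Supremum" "HOL-Analysis.Analysis"
begin

definition C2 :: "(real \<Rightarrow> real) \<Rightarrow> bool" where
  "C2 W \<longleftrightarrow> W differentiable_on UNIV \<and> deriv W differentiable_on UNIV
     \<and> continuous_on UNIV (deriv (deriv W))"

definition double_well :: "(real \<Rightarrow> real) \<Rightarrow> bool" where
  "double_well W \<longleftrightarrow> (\<forall>t. 0 \<le> W t) \<and> C2 W
     \<and> W 1 = 0 \<and> W (- 1) = 0 \<and> (\<forall>t. t \<noteq> 1 \<and> t \<noteq> - 1 \<longrightarrow> 0 < W t)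
     \<and> deriv W 1 = 0 \<and> deriv W (- 1) = 0
     \<and> 0 < deriv (deriv W) 1 \<and> 0 < deriv (deriv W) (- 1)"

text \<open>
  Near each boundary point the set is the strict epigraph of a Lipschitz function in some
  orthonormal coordinate system. The unit vector \<open>\<nu>\<close> is the last coordinate direction; the
  graph function \<open>g\<close> lives on the hyperplane orthogonal to \<open>\<nu>\<close>, which plays the role of the
  space of the remaining coordinates, and its values off that hyperplane are irrelevant.
\<close>
definition lipschitz_boundary :: "(real ^ 'n) set \<Rightarrow> bool" where
  "lipschitz_boundary \<Omega> \<longleftrightarrow>
     (\<forall>p\<in>frontier \<Omega>. \<exists>r>0. \<exists>\<nu>. \<exists>g. norm \<nu> = 1
        \<and> (\<exists>L. L-lipschitz_on {y. y \<bullet> \<nu> = 0} g)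
        \<and> \<Omega> \<inter> ball p r = {x \<in> ball p r. g (x - (x \<bullet> \<nu>) *\<^sub>R \<nu>) < x \<bullet> \<nu>})"

text \<open>Elements of \<open>L\<^sup>1\<close>-loc are represented by Lebesgue measurable functions defined everywhere.\<close>
definition L1_loc :: "(real ^ 'n \<Rightarrow> real) set" where
  "L1_loc = {u. \<forall>K. compact K \<longrightarrow> u absolutely_integrable_on K}"

definition Linf_norm :: "(real ^ 'n) set \<Rightarrow> (real ^ 'n \<Rightarrow> real) \<Rightarrow> ennreal" where
  "Linf_norm \<Omega> u = esssup (lebesgue_on \<Omega>) (\<lambda>x. ennreal \<bar>u x\<bar>)"

definition Z :: "(real ^ 'n) set \<Rightarrow> real \<Rightarrow> real \<Rightarrow> (real ^ 'n \<Rightarrow> real) set" where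
  "Z \<Omega> M m = {u \<in> L1_loc. Linf_norm \<Omega> u \<le> ennreal M \<and> (LINT x:\<Omega>|lebesgue. u x) = m}"

text \<open>
  The energies take values in \<open>[0,\<infinity>]\<close>. On the diagonal the kernel is \<open>0 / 0 = 0\<close>; this is
  a null set.
\<close>
definition kernel :: "real \<Rightarrow> (real ^ 'n \<Rightarrow> real) \<Rightarrow> real ^ 'n \<Rightarrow> real ^ 'n \<Rightarrow> real" where
  "kernel s u x y = \<bar>u x - u y\<bar>\<^sup>2 / norm (x - y) powr (real CARD('n) + 2 * s)"

definition K_energy :: "real \<Rightarrow> (real ^ 'n \<Rightarrow> real) \<Rightarrow> (real ^ 'n) set \<Rightarrow> ennreal" where
  "K_energy s u \<Omega> =
     (1 / 2) * (\<integral>\<^sup>+y\<in>\<Omega>. (\<integral>\<^sup>+x\<in>\<Omega>. ennreal (kernel s u x y) \<partial>lebesgue) \<partial>lebesgue)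
     + (\<integral>\<^sup>+y\<in>\<Omega>. (\<integral>\<^sup>+x\<in>- \<Omega>. ennreal (kernel s u x y) \<partial>lebesgue) \<partial>lebesgue)"

definition kappa :: "real \<Rightarrow> real \<Rightarrow> real" where
  "kappa s \<epsilon> =
     (if s < 1 / 2 then \<epsilon> powr (- 2 * s)
      else if s = 1 / 2 then inverse \<bar>\<epsilon> * ln \<epsilon>\<bar>
      else inverse \<epsilon>)"

definition F_energy ::
    "(real \<Rightarrow> real) \<Rightarrow> real \<Rightarrow> real \<Rightarrow> (real ^ 'n \<Rightarrow> real) \<Rightarrow> (real ^ 'n) set \<Rightarrow> ennreal" where
  "F_energy W s \<epsilon> u \<Omega> =
     ennreal (kappa s \<epsilon>) *
       (ennreal (\<epsilon> powr (2 * s)) * K_energy s u \<Omega> + (\<integral>\<^sup>+x\<in>\<Omega>. ennreal (W (u x)) \<partial>lebesgue))"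

definition minimizer ::
    "(real \<Rightarrow> real) \<Rightarrow> real \<Rightarrow> real \<Rightarrow> (real ^ 'n) set \<Rightarrow> real \<Rightarrow> real \<Rightarrow> (real ^ 'n \<Rightarrow> real) \<Rightarrow> bool" where
  "minimizer W s \<epsilon> \<Omega> M m u \<longleftrightarrow>
     u \<in> Z \<Omega> M m \<and> (\<forall>v\<in>Z \<Omega> M m. F_energy W s \<epsilon> u \<Omega> \<le> F_energy W s \<epsilon> v \<Omega>)"

end

theory Submission
  imports Defs
begin

text \<open>
  The competitor is a one-dimensional ramp of width \<open>\<epsilon>\<close> across a hyperplane \<open>x\<^sub>i = t\<close>, where
  \<open>t\<close> is chosen by the intermediate value theorem so that the mass is exactly \<open>m\<close>. With
  \<open>\<rho>(y) = max \<epsilon> \<bar>y\<^sub>i - t\<bar>\<close> its increments satisfy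
  \<open>\<bar>v x - v y\<bar> \<le> 2 min 1 (\<bar>x - y\<bar> / \<rho>(y))\<close>, so that the inner integral of the kernel over all of
  space is \<open>O(\<rho>(y)\<^sup>-\<^sup>2\<^sup>s)\<close>; the potential is \<open>O(\<epsilon>\<^sup>2\<^sup>s \<rho>(y)\<^sup>-\<^sup>2\<^sup>s)\<close> as well, since it vanishes
  off the transition layer. Integrating \<open>\<rho>\<^sup>-\<^sup>2\<^sup>s\<close> over a box containing \<open>\<Omega>\<close> gives \<open>O(1)\<close>,
  \<open>O(\<bar>log \<epsilon>\<bar>)\<close> or \<open>O(\<epsilon>\<^sup>1\<^sup>-\<^sup>2\<^sup>s)\<close> according to \<open>s < 1/2\<close>, \<open>s = 1/2\<close> or \<open>s > 1/2\<close>, which is what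
  the factor \<open>\<kappa>\<^sub>\<epsilon> \<epsilon>\<^sup>2\<^sup>s\<close> compensates. For \<open>s = 1/2\<close> this factor is \<open>1 / \<bar>log \<epsilon>\<bar>\<close>, unbounded as
  \<open>\<epsilon> \<rightarrow> 1\<close>; but a sequence in \<open>(0, 1)\<close> tending to \<open>0\<close> stays below some \<open>\<epsilon>\<^sub>0 < 1\<close>.
\<close>

section \<open>The truncated kernel and its integral over dyadic annuli\<close>

text \<open>On the annulus the integrand is at most \<open>\<rho> powr - p\<close>, and the annulus
  lies in a ball of radius \<open>2 * \<rho>\<close>, whose volume supplies the other
  factors.\<close>

lemma nn_integral_annulus_powr_le:
  fixes y :: "'a::euclidean_space"
  assumes "0 < \<rho>" "0 \<le> p"
  shows "(\<integral>\<^sup>+x. ennreal (norm (x - y) powr - p) *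
            indicator {x. \<rho> < norm (x - y) \<and> norm (x - y) \<le> 2 * \<rho>} x \<partial>lborel)
         \<le> ennreal (unit_ball_vol (real DIM('a)) * 2 ^ DIM('a) * \<rho> powr (real DIM('a) - p))"
proof -
  have "(\<integral>\<^sup>+x. ennreal (norm (x - y) powr - p) *
            indicator {x. \<rho> < norm (x - y) \<and> norm (x - y) \<le> 2 * \<rho>} x \<partial>lborel)
        \<le> (\<integral>\<^sup>+x. ennreal (\<rho> powr - p) * indicator (cball y (2 * \<rho>)) x \<partial>lborel)"
    using assms
    by (intro nn_integral_mono)
       (auto simp: dist_norm norm_minus_commute split: split_indicator intro!: ennreal_leI powr_mono2')
  also have "\<dots> = ennreal (\<rho> powr - p) * emeasure lborel (cball y (2 * \<rho>))"
    by (simp add: nn_integral_cmult_indicator)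
  also have "\<dots> = ennreal (\<rho> powr - p) * ennreal (unit_ball_vol (real DIM('a)) * (2 * \<rho>) ^ DIM('a))"
    using assms by (simp add: emeasure_cball)
  also have "\<dots> = ennreal (unit_ball_vol (real DIM('a)) * 2 ^ DIM('a) * \<rho> powr (real DIM('a) - p))"
    using assms
    by (simp flip: ennreal_mult add: powr_diff powr_realpow powr_minus power_mult_distrib field_simps)
  finally show ?thesis .
qed

text \<open>The annuli of inner radius \<open>\<rho>\<close> times an integer power of 2 cover the
  positive half-line. Splitting by the sign of the exponent gives two families indexed by naturals,
  ready for two series: exponent \<open>j\<close> in the far case, \<open>- (j + 1)\<close> in the
  near case.\<close>

lemma dyadic_annulus_exists:
  fixes r \<rho> :: real
  assumes "0 < r" "0 < \<rho>"
  obtains (far) j :: nat where "2 ^ j * \<rho> < r" "r \<le> 2 * (2 ^ j * \<rho>)"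
        | (near) j :: nat where "\<rho> / 2 ^ Suc j < r" "r \<le> 2 * (\<rho> / 2 ^ Suc j)"
proof -
  \<comment> \<open>A ceiling minus one rather than a floor, because the annuli are open at the
    inner radius and closed at the outer one.\<close>
  define k where "k = \<lceil>log 2 (r / \<rho>)\<rceil> - 1"
  have k: "real_of_int k < log 2 (r / \<rho>)" "log 2 (r / \<rho>) \<le> real_of_int k + 1"
    unfolding k_def by linarith+
  have lt: "2 powr real_of_int k < r / \<rho>"
    using k(1) assms by (simp add: less_log_iff)
  have "r / \<rho> \<le> 2 powr (real_of_int k + 1)"
    using k(2) assms by (simp add: log_le_iff)
  then have le: "r / \<rho> \<le> 2 * 2 powr real_of_int k"
    by (simp add: powr_add)
  show thesis
  proof (cases "0 \<le> k")
    case True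
    then obtain j where "k = int j" using nonneg_int_cases by blast
    then show thesis using lt le assms
      by (intro far[of j]) (auto simp: powr_realpow field_simps)
  next
    case False
    then obtain j where "k = - int (Suc j)"
      by (metis int_cases not_le_imp_less of_nat_0_le_iff)
    then have *: "2 powr real_of_int k = 1 / 2 ^ Suc j"
      by (metis of_int_minus of_int_of_nat_eq powr_minus_divide powr_realpow zero_less_numeral)
    show thesis using lt le assms unfolding *
      by (intro near[of j]) (auto simp: field_simps)
  qed
qed

lemma ennreal_le_suminf: "f j \<le> suminf f" for f :: "nat \<Rightarrow> ennreal"
  using sum_le_suminf[of f "{j}"] by simp

lemma suminf_ennreal_geometric:
  fixes c a :: real
  assumes "0 \<le> c" "0 \<le> a" "a < 1"
  shows "(\<Sum>j. ennreal (c * a ^ j)) = ennreal (c / (1 - a))"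
  using assms sums_mult[OF geometric_sums[of a], of c]
  by (intro suminf_ennreal_eq) auto

text \<open>Each annulus of inner radius \<open>d\<close> contributes
  \<open>O(d powr (- 2 * s))\<close>. Going outward these terms decay with ratio \<open>a\<close>,
  which is below 1 because \<open>0 < s\<close>. Going inward they grow, but the squared truncation
  gains a factor \<open>1 / 4\<close> per annulus, and the ratio \<open>b\<close> is below 1 because
  \<open>s < 1\<close>. The constant depends on neither \<open>y\<close> nor
  \<open>\<rho>\<close>.\<close>

lemma nn_integral_truncated_kernel_bound:
  assumes "0 < s" "s < 1"
  obtains C where "0 \<le> C"
    "\<And>(y::'a::euclidean_space) \<rho>. 0 < \<rho> \<Longrightarrow>
      (\<integral>\<^sup>+x. ennreal ((min 1 (norm (x - y) / \<rho>))\<^sup>2 / norm (x - y) powr (real DIM('a) + 2 * s)) \<partial>lborel)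
      \<le> ennreal (C * \<rho> powr (- 2 * s))"
proof -
  define V where "V = unit_ball_vol (real DIM('a)) * 2 ^ DIM('a)"
  define p where "p = real DIM('a) + 2 * s"
  define a where "a = 2 powr (- 2 * s)"
  define b where "b = 2 powr (2 * s) / 4"
  have "0 \<le> V" by (simp add: V_def)
  have a: "0 \<le> a" "a < 1"
    using assms by (auto simp: a_def powr_less_one)
  have "2 powr (2 * s) < 2 powr 2"
    using assms by (intro powr_less_mono) auto
  then have b: "0 \<le> b" "b < 1"
    by (auto simp: b_def)
  have "0 \<le> p" using assms by (simp add: p_def)
  show thesis
  proof (rule that)
    show "0 \<le> V / (1 - a) + V * 2 powr (2 * s) / (1 - b)"
      using a b \<open>0 \<le> V\<close> by simp
  next
    fix y :: 'a and \<rho> :: real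
    assume \<rho>: "0 < \<rho>"
    define A where "A d = {x::'a. d < norm (x - y) \<and> norm (x - y) \<le> 2 * d}" for d :: real
    have [measurable]: "A d \<in> sets borel" for d
      unfolding A_def by measurable
    define g where "g d x = ennreal (norm (x - y) powr - p) * indicator (A d) x" for d x
    have [measurable]: "g d \<in> borel_measurable borel" for d
      unfolding g_def by measurable
    have int_g: "(\<integral>\<^sup>+x. g d x \<partial>lborel) \<le> ennreal (V * d powr (- 2 * s))" if "0 < d" for d
      using nn_integral_annulus_powr_le[OF that \<open>0 \<le> p\<close>, of y]
      unfolding g_def A_def V_def by (simp add: p_def)
    have far_scale: "(2 ^ j * \<rho>) powr (- 2 * s) = \<rho> powr (- 2 * s) * a ^ j" for j
      using \<rho> by (simp add: a_def powr_mult powr_powr mult.commute flip: powr_realpow)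
    have near_scale: "(\<rho> / 2 ^ Suc j) powr (- 2 * s) / 4 ^ j
        = 2 powr (2 * s) * \<rho> powr (- 2 * s) * b ^ j" for j
    proof -
      have "(\<rho> / 2 ^ Suc j) powr (- 2 * s) = \<rho> powr (- 2 * s) * (2 ^ Suc j) powr (2 * s)"
        using \<rho> by (simp add: powr_divide powr_minus field_simps)
      also have "(2 ^ Suc j) powr (2 * s) = (2 powr (2 * s)) ^ Suc j"
        by (simp add: powr_powr powr_mult mult.commute flip: powr_realpow)
      finally show ?thesis by (simp add: b_def power_divide)
    qed
    \<comment> \<open>A point \<open>x\<close> other than \<open>y\<close> lies in some annulus, and
      that single term of the series already dominates: the truncation is at most 1 in a far annulus
      and at most \<open>1 / 2 ^ j\<close> in a near one. At \<open>x = y\<close> the left side is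
      0.\<close>
    have pw: "ennreal ((min 1 (norm (x - y) / \<rho>))\<^sup>2 / norm (x - y) powr p)
        \<le> (\<Sum>j. g (2 ^ j * \<rho>) x) + (\<Sum>j. ennreal (1 / 4 ^ j) * g (\<rho> / 2 ^ Suc j) x)" (is "?l x \<le> ?f x + ?n x")
      for x
    proof (cases "x = y")
      case False
      then have r: "0 < norm (x - y)" by simp
      show ?thesis
      using r \<rho> proof (cases rule: dyadic_annulus_exists)
        case (far j)
        have "?l x \<le> g (2 ^ j * \<rho>) x"
          using far \<rho> r unfolding g_def A_def
          by (auto simp: powr_minus field_simps abs_square_le_1 intro!: ennreal_leI)
        also have "\<dots> \<le> ?f x" by (rule ennreal_le_suminf)
        finally show ?thesis by (simp add: add_increasing2)
      next
        case (near j)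
        have "norm (x - y) / \<rho> \<le> 1 / 2 ^ j"
          using near \<rho> by (simp add: field_simps)
        then have "(min 1 (norm (x - y) / \<rho>))\<^sup>2 \<le> (1 / 2 ^ j)\<^sup>2"
          using \<rho> by (intro power_mono) auto
        also have "\<dots> = 1 / 4 ^ j"
          by (simp add: power_divide flip: power_mult_distrib power_mult[of 2 j 2] power_mult[of 2 2 j])
             (simp add: power_mult power2_eq_square power_mult_distrib[symmetric])
        finally have "(min 1 (norm (x - y) / \<rho>))\<^sup>2 / norm (x - y) powr p \<le> 1 / 4 ^ j * norm (x - y) powr - p"
          using r by (simp add: powr_minus divide_right_mono field_simps)
        then have "?l x \<le> ennreal (1 / 4 ^ j) * g (\<rho> / 2 ^ Suc j) x"
          using near unfolding g_def A_def
          by (auto simp flip: ennreal_mult intro!: ennreal_leI)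
        also have "\<dots> \<le> ?n x" by (rule ennreal_le_suminf)
        finally show ?thesis by (simp add: add_increasing)
      qed
    qed simp
    have "(\<integral>\<^sup>+x. ?l x \<partial>lborel) \<le> (\<integral>\<^sup>+x. ?f x + ?n x \<partial>lborel)"
      by (intro nn_integral_mono pw)
    also have "\<dots> = (\<Sum>j. \<integral>\<^sup>+x. g (2 ^ j * \<rho>) x \<partial>lborel)
        + (\<Sum>j. ennreal (1 / 4 ^ j) * (\<integral>\<^sup>+x. g (\<rho> / 2 ^ Suc j) x \<partial>lborel))"
      by (simp add: nn_integral_add nn_integral_suminf nn_integral_cmult)
    also have "\<dots> \<le> (\<Sum>j. ennreal (V * \<rho> powr (- 2 * s) * a ^ j))
        + (\<Sum>j. ennreal (V * 2 powr (2 * s) * \<rho> powr (- 2 * s) * b ^ j))"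
    proof (intro add_mono suminf_le summableI)
      fix j
      show "(\<integral>\<^sup>+x. g (2 ^ j * \<rho>) x \<partial>lborel) \<le> ennreal (V * \<rho> powr (- 2 * s) * a ^ j)"
        using int_g[of "2 ^ j * \<rho>"] \<rho> unfolding far_scale by (simp add: mult.assoc)
      have "ennreal (1 / 4 ^ j) * (\<integral>\<^sup>+x. g (\<rho> / 2 ^ Suc j) x \<partial>lborel)
          \<le> ennreal (1 / 4 ^ j) * ennreal (V * (\<rho> / 2 ^ Suc j) powr (- 2 * s))"
        using \<rho> by (intro mult_left_mono int_g) auto
      also have "\<dots> = ennreal (V * ((\<rho> / 2 ^ Suc j) powr (- 2 * s) / 4 ^ j))"
        using \<open>0 \<le> V\<close> by (subst ennreal_mult[symmetric]) auto
      also have "\<dots> = ennreal (V * 2 powr (2 * s) * \<rho> powr (- 2 * s) * b ^ j)"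
        unfolding near_scale by (simp add: mult_ac)
      finally show "ennreal (1 / 4 ^ j) * (\<integral>\<^sup>+x. g (\<rho> / 2 ^ Suc j) x \<partial>lborel)
          \<le> ennreal (V * 2 powr (2 * s) * \<rho> powr (- 2 * s) * b ^ j)" .
    qed
    also have "\<dots> = ennreal (V * \<rho> powr (- 2 * s) / (1 - a)) + ennreal (V * 2 powr (2 * s) * \<rho> powr (- 2 * s) / (1 - b))"
      using a b \<open>0 \<le> V\<close> by (subst (1 2) suminf_ennreal_geometric) auto
    also have "\<dots> = ennreal ((V / (1 - a) + V * 2 powr (2 * s) / (1 - b)) * \<rho> powr (- 2 * s))"
      using a b \<open>0 \<le> V\<close> by (subst ennreal_plus[symmetric]) (auto simp: field_simps)
    finally show "(\<integral>\<^sup>+x. ennreal ((min 1 (norm (x - y) / \<rho>))\<^sup>2 / norm (x - y) powr (real DIM('a) + 2 * s)) \<partial>lborel)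
      \<le> ennreal ((V / (1 - a) + V * 2 powr (2 * s) / (1 - b)) * \<rho> powr (- 2 * s))"
      unfolding p_def .
  qed
qed

section \<open>The one-dimensional profile integral and its scaling\<close>

text \<open>The middle interval, where the maximum is \<open>\<epsilon>\<close>, has length
  \<open>2 * \<epsilon>\<close>; the two outer ones agree by reflection and are integrated with
  \<open>F\<close>. The antiderivative is left as a parameter so that powers and the logarithm are
  covered at once.\<close>

lemma nn_integral_max_powr_le:
  fixes \<epsilon> L p :: real and F :: "real \<Rightarrow> real"
  assumes "0 < \<epsilon>" "\<epsilon> \<le> L"
    and F: "\<And>\<tau>. 0 < \<tau> \<Longrightarrow> (F has_real_derivative \<tau> powr p) (at \<tau>)"
  shows "(\<integral>\<^sup>+\<tau>. ennreal (max \<epsilon> \<bar>\<tau>\<bar> powr p) * indicator {- L..L} \<tau> \<partial>lborel)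
         \<le> ennreal (2 * \<epsilon> powr (1 + p) + 2 * (F L - F \<epsilon>))"
proof -
  have FTC: "(\<integral>\<^sup>+\<tau>. ennreal (\<tau> powr p) * indicator {\<epsilon>..L} \<tau> \<partial>lborel) = ennreal (F L - F \<epsilon>)"
    using assms by (intro nn_integral_FTC_Icc) (auto intro: has_field_derivative_at_within)
  have refl: "(\<integral>\<^sup>+\<tau>. ennreal ((- \<tau>) powr p) * indicator {\<epsilon>..L} (- \<tau>) \<partial>lborel) = ennreal (F L - F \<epsilon>)"
    unfolding FTC[symmetric]
    using nn_integral_real_affine[of "\<lambda>\<tau>. ennreal (\<tau> powr p) * indicator {\<epsilon>..L} \<tau>" "-1" 0]
    by simp
  have "F \<epsilon> \<le> F L"
    using assms by (intro DERIV_nonneg_imp_nondecreasing[of \<epsilon> L F]) (auto intro!: exI F)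
  have "(\<integral>\<^sup>+\<tau>. ennreal (max \<epsilon> \<bar>\<tau>\<bar> powr p) * indicator {- L..L} \<tau> \<partial>lborel)
     \<le> (\<integral>\<^sup>+\<tau>. ennreal (\<epsilon> powr p) * indicator {- \<epsilon>..\<epsilon>} \<tau> + (ennreal (\<tau> powr p) * indicator {\<epsilon>..L} \<tau>
          + ennreal ((- \<tau>) powr p) * indicator {\<epsilon>..L} (- \<tau>)) \<partial>lborel)"
    using assms by (intro nn_integral_mono) (auto split: split_indicator simp: max_def abs_if)
  also have "\<dots> = ennreal (\<epsilon> powr p) * ennreal (2 * \<epsilon>) + (ennreal (F L - F \<epsilon>) + ennreal (F L - F \<epsilon>))"
    using assms by (simp add: nn_integral_add FTC refl nn_integral_cmult_indicator)
  also have "\<dots> = ennreal (2 * \<epsilon> powr (1 + p) + 2 * (F L - F \<epsilon>))"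
    using assms \<open>F \<epsilon> \<le> F L\<close>
    by (simp add: powr_add field_simps flip: ennreal_mult ennreal_plus)
  finally show ?thesis .
qed

text \<open>The prefactor \<open>kappa s \<epsilon> * \<epsilon> powr (2 * s)\<close> is 1,
  \<open>1 / (- ln \<epsilon>)\<close> or \<open>\<epsilon> powr (2 * s - 1)\<close> in the three
  regimes, exactly the inverse of the growth of the integral.\<close>

lemma kappa_profile_integral_bound:
  assumes "0 < s" "s < 1" "\<epsilon>0 < 1" "1 \<le> L"
  obtains C where "0 \<le> C"
    "\<And>\<epsilon>. 0 < \<epsilon> \<Longrightarrow> \<epsilon> \<le> \<epsilon>0 \<Longrightarrow>
      ennreal (kappa s \<epsilon> * \<epsilon> powr (2 * s)) *
        (\<integral>\<^sup>+\<tau>. ennreal (max \<epsilon> \<bar>\<tau>\<bar> powr (- 2 * s)) * indicator {- L..L} \<tau> \<partial>lborel) \<le> ennreal C"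
proof -
  note pick = that
  \<comment> \<open>Each regime now only has to supply an antiderivative \<open>F\<close> and a
    bound on a closed real expression.\<close>
  have reduce: thesis
    if "0 \<le> C" and F: "\<And>\<tau>. 0 < \<tau> \<Longrightarrow> (F has_real_derivative \<tau> powr (- 2 * s)) (at \<tau>)"
      and C: "\<And>\<epsilon>. 0 < \<epsilon> \<Longrightarrow> \<epsilon> \<le> \<epsilon>0 \<Longrightarrow>
        kappa s \<epsilon> * \<epsilon> powr (2 * s) * (2 * \<epsilon> powr (1 - 2 * s) + 2 * (F L - F \<epsilon>)) \<le> C" for C F
  proof (rule pick[OF \<open>0 \<le> C\<close>])
    fix \<epsilon> assume \<epsilon>: "0 < \<epsilon>" "\<epsilon> \<le> \<epsilon>0"
    have k: "0 \<le> kappa s \<epsilon> * \<epsilon> powr (2 * s)"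
      using \<epsilon> by (auto simp: kappa_def)
    have "ennreal (kappa s \<epsilon> * \<epsilon> powr (2 * s)) *
        (\<integral>\<^sup>+\<tau>. ennreal (max \<epsilon> \<bar>\<tau>\<bar> powr (- 2 * s)) * indicator {- L..L} \<tau> \<partial>lborel)
      \<le> ennreal (kappa s \<epsilon> * \<epsilon> powr (2 * s)) * ennreal (2 * \<epsilon> powr (1 + (- 2 * s)) + 2 * (F L - F \<epsilon>))"
      using \<epsilon> assms by (intro mult_left_mono nn_integral_max_powr_le F) auto
    also have "\<dots> = ennreal (kappa s \<epsilon> * \<epsilon> powr (2 * s) * (2 * \<epsilon> powr (1 - 2 * s) + 2 * (F L - F \<epsilon>)))"
      using k by (simp add: ennreal_mult')
    also have "\<dots> \<le> ennreal C"
      using C[OF \<epsilon>] by (rule ennreal_leI)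
    finally show "ennreal (kappa s \<epsilon> * \<epsilon> powr (2 * s)) *
        (\<integral>\<^sup>+\<tau>. ennreal (max \<epsilon> \<bar>\<tau>\<bar> powr (- 2 * s)) * indicator {- L..L} \<tau> \<partial>lborel) \<le> ennreal C" .
  qed
  have pow: "((\<lambda>\<tau>. \<tau> powr (1 - 2 * s) / (1 - 2 * s)) has_real_derivative \<tau> powr (- 2 * s)) (at \<tau>)"
    if "0 < \<tau>" "s \<noteq> 1 / 2" for \<tau>
    using that by (auto intro!: derivative_eq_intros)
  consider "s < 1 / 2" | "s = 1 / 2" | "1 / 2 < s" by linarith
  then show thesis
  proof cases
    case 1
    show thesis
    proof (rule reduce[OF _ pow])
      show "0 \<le> 2 + 2 * (L powr (1 - 2 * s) / (1 - 2 * s))" using 1 by simp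
      fix \<epsilon> assume \<epsilon>: "0 < \<epsilon>" "\<epsilon> \<le> \<epsilon>0"
      have aux: "2 * x + 2 * (a - b) \<le> 2 + 2 * a" if "x \<le> 1" "0 \<le> b" for x a b :: real
        using that by simp
      have k: "kappa s \<epsilon> * \<epsilon> powr (2 * s) = 1"
        using 1 \<epsilon> by (simp add: kappa_def flip: powr_add)
      have "\<epsilon> powr (1 - 2 * s) \<le> 1"
        using 1 \<epsilon> assms by (intro powr_le1) auto
      moreover have "0 \<le> \<epsilon> powr (1 - 2 * s) / (1 - 2 * s)"
        using 1 by simp
      ultimately show "kappa s \<epsilon> * \<epsilon> powr (2 * s) * (2 * \<epsilon> powr (1 - 2 * s) + 2 *
            (L powr (1 - 2 * s) / (1 - 2 * s) - \<epsilon> powr (1 - 2 * s) / (1 - 2 * s)))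
          \<le> 2 + 2 * (L powr (1 - 2 * s) / (1 - 2 * s))"
        unfolding k mult_1 by (rule aux)
    qed (use 1 in auto)
  next
    case 2
    show thesis
    \<comment> \<open>If \<open>\<epsilon>0 \<le> 0\<close>, no \<open>\<epsilon>\<close> is in
      range and the constant 0 serves.\<close>
    proof (cases "0 < \<epsilon>0")
      case True
      \<comment> \<open>A positive lower bound for \<open>- ln \<epsilon>\<close>, uniform over
        \<open>\<epsilon> \<le> \<epsilon>0\<close>; it controls the part of the quotient that does
        not cancel against the logarithm.\<close>
      define \<Lambda> where "\<Lambda> = - ln \<epsilon>0"
      have \<Lambda>: "0 < \<Lambda>" using True assms by (simp add: \<Lambda>_def ln_less_zero)
      show thesis
      proof (rule reduce[of "(2 + 2 * ln L) / \<Lambda> + 2" ln])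
        show "0 \<le> (2 + 2 * ln L) / \<Lambda> + 2" using \<Lambda> assms by simp
        show "(ln has_real_derivative \<tau> powr (- 2 * s)) (at \<tau>)" if "0 < \<tau>" for \<tau>
          using that 2 by (auto intro!: derivative_eq_intros simp: powr_minus field_simps)
        fix \<epsilon> assume \<epsilon>: "0 < \<epsilon>" "\<epsilon> \<le> \<epsilon>0"
        then have l: "\<Lambda> \<le> - ln \<epsilon>" using True by (simp add: \<Lambda>_def)
        have "kappa s \<epsilon> * \<epsilon> powr (2 * s) = 1 / (- ln \<epsilon>)"
          using 2 \<epsilon> l \<Lambda> by (simp add: kappa_def abs_mult field_simps)
        moreover have "1 / (- ln \<epsilon>) * (2 * \<epsilon> powr (1 - 2 * s) + 2 * (ln L - ln \<epsilon>))
            = (2 + 2 * ln L) / (- ln \<epsilon>) + 2"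
          using l \<Lambda> \<epsilon>(1) unfolding 2 by (auto simp: add_divide_distrib diff_divide_distrib)
        moreover have "(2 + 2 * ln L) / (- ln \<epsilon>) \<le> (2 + 2 * ln L) / \<Lambda>"
          using l \<Lambda> assms by (intro divide_left_mono) (auto intro: mult_neg_pos)
        ultimately show "kappa s \<epsilon> * \<epsilon> powr (2 * s) * (2 * \<epsilon> powr (1 - 2 * s) + 2 * (ln L - ln \<epsilon>))
            \<le> (2 + 2 * ln L) / \<Lambda> + 2" by simp
      qed
    qed (use that[of 0] in auto)
  next
    case 3
    show thesis
    proof (rule reduce[OF _ pow])
      show "0 \<le> 2 + 2 / (2 * s - 1)" using 3 by simp
      fix \<epsilon> assume \<epsilon>: "0 < \<epsilon>" "\<epsilon> \<le> \<epsilon>0"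
      have k: "kappa s \<epsilon> * \<epsilon> powr (2 * s) = \<epsilon> powr (2 * s - 1)"
        using 3 \<epsilon> by (simp add: kappa_def powr_diff field_simps)
      have e: "\<epsilon> powr (2 * s - 1) * \<epsilon> powr (1 - 2 * s) = 1"
        using \<epsilon> by (simp flip: powr_add)
      \<comment> \<open>For \<open>s > 1 / 2\<close> the antiderivative is negative: now its value
        at \<open>L\<close> is dropped, while its value at \<open>\<epsilon>\<close>, here
        \<open>- b\<close>, carries the main term.\<close>
      have aux: "2 * x + 2 * (a - - b) \<le> 2 * x + 2 * b" if "a \<le> 0" for x a b :: real
        using that by simp
      have "L powr (1 - 2 * s) / (1 - 2 * s) \<le> 0"
        using 3 by (simp add: divide_nonneg_neg)
      note aux[OF this, of "\<epsilon> powr (1 - 2 * s)" "\<epsilon> powr (1 - 2 * s) / (2 * s - 1)"]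
      moreover have "\<epsilon> powr (1 - 2 * s) / (1 - 2 * s) = - (\<epsilon> powr (1 - 2 * s) / (2 * s - 1))"
        by (simp add: minus_divide_right)
      moreover have "\<epsilon> powr (1 - 2 * s) * (2 + 2 / (2 * s - 1))
          = 2 * \<epsilon> powr (1 - 2 * s) + 2 * (\<epsilon> powr (1 - 2 * s) / (2 * s - 1))"
        by (simp add: distrib_left)
      ultimately have "\<epsilon> powr (2 * s - 1) * (2 * \<epsilon> powr (1 - 2 * s) + 2 *
            (L powr (1 - 2 * s) / (1 - 2 * s) - \<epsilon> powr (1 - 2 * s) / (1 - 2 * s)))
          \<le> \<epsilon> powr (2 * s - 1) * (\<epsilon> powr (1 - 2 * s) * (2 + 2 / (2 * s - 1)))"
        by (intro mult_left_mono) simp_all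
      also have "\<dots> = 2 + 2 / (2 * s - 1)"
        using e by (simp flip: mult.assoc)
      finally show "kappa s \<epsilon> * \<epsilon> powr (2 * s) * (2 * \<epsilon> powr (1 - 2 * s) + 2 *
            (L powr (1 - 2 * s) / (1 - 2 * s) - \<epsilon> powr (1 - 2 * s) / (1 - 2 * s)))
          \<le> 2 + 2 / (2 * s - 1)" unfolding k .
    qed (use 3 in auto)
  qed
qed

section \<open>Reduction to one variable\<close>

text \<open>Enlarging \<open>S\<close> to the cube of half-side \<open>R\<close> makes the integrand
  a product over coordinates. Each direction other than \<open>e\<close> contributes
  \<open>2 * R\<close>; in direction \<open>e\<close>, translating by \<open>t\<close> keeps the
  interval inside the one of half-length \<open>R + T\<close>.\<close>

lemma nn_integral_slab_le:
  fixes e :: "'a::euclidean_space" and w :: "real \<Rightarrow> ennreal"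
  assumes e: "e \<in> Basis" and [measurable]: "w \<in> borel_measurable borel"
    and "0 \<le> R" "\<bar>t\<bar> \<le> T"
    and S: "\<And>y b. y \<in> S \<Longrightarrow> b \<in> Basis \<Longrightarrow> \<bar>y \<bullet> b\<bar> \<le> R"
  shows "(\<integral>\<^sup>+y\<in>S. w (y \<bullet> e - t) \<partial>lborel)
    \<le> ennreal ((2 * R) ^ (DIM('a) - 1)) * (\<integral>\<^sup>+\<tau>. w \<tau> * indicator {- (R + T)..R + T} \<tau> \<partial>lborel)"
proof -
  define f where "f b \<tau> = (if b = e then w (\<tau> - t) else 1) * indicator {- R..R} \<tau>" for b :: 'a and \<tau> :: real
  have [measurable]: "f b \<in> borel_measurable borel" for b
    unfolding f_def by (cases "b = e") auto
  have "w (y \<bullet> e - t) * indicator S y \<le> (\<Prod>b\<in>Basis. f b (y \<bullet> b))" for y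
  proof (cases "y \<in> S")
    case True
    then have "f b (y \<bullet> b) = (if b = e then w (y \<bullet> e - t) else 1)" if "b \<in> Basis" for b
      using S[OF True that] by (auto simp: f_def abs_le_iff split: split_indicator)
    then have "(\<Prod>b\<in>Basis. f b (y \<bullet> b)) = (\<Prod>b\<in>Basis. if b = e then w (y \<bullet> e - t) else 1)"
      by (intro prod.cong) auto
    also have "\<dots> = w (y \<bullet> e - t)" using e by (simp add: prod.delta)
    finally show ?thesis using True by simp
  qed simp
  then have "(\<integral>\<^sup>+y\<in>S. w (y \<bullet> e - t) \<partial>lborel) \<le> (\<integral>\<^sup>+y. (\<Prod>b\<in>Basis. f b (y \<bullet> b)) \<partial>lborel)"
    by (intro nn_integral_mono)
  also have "\<dots> = (\<Prod>b\<in>Basis. \<integral>\<^sup>+\<tau>. f b \<tau> \<partial>lborel)"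
    by (rule nn_integral_lborel_prod) auto
  also have "\<dots> = (\<integral>\<^sup>+\<tau>. f e \<tau> \<partial>lborel) * (\<Prod>b\<in>Basis - {e}. \<integral>\<^sup>+\<tau>. f b \<tau> \<partial>lborel)"
    using e by (intro prod.remove) auto
  also have "(\<Prod>b\<in>Basis - {e}. \<integral>\<^sup>+\<tau>. f b \<tau> \<partial>lborel) = (\<Prod>b\<in>Basis - {e}. ennreal (2 * R))"
    using \<open>0 \<le> R\<close> by (intro prod.cong) (auto simp: f_def)
  also have "\<dots> = ennreal ((2 * R) ^ (DIM('a) - 1))"
    using e \<open>0 \<le> R\<close> by (simp add: ennreal_power)
  also have "(\<integral>\<^sup>+\<tau>. f e \<tau> \<partial>lborel) = (\<integral>\<^sup>+\<tau>. f e (t + \<tau>) \<partial>lborel)"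
    using nn_integral_real_affine[of "f e" 1 t] by simp
  also have "\<dots> \<le> (\<integral>\<^sup>+\<tau>. w \<tau> * indicator {- (R + T)..R + T} \<tau> \<partial>lborel)"
    using \<open>\<bar>t\<bar> \<le> T\<close> by (intro nn_integral_mono) (auto simp: f_def split: split_indicator)
  finally show ?thesis by (simp add: mult.commute mult_right_mono)
qed

section \<open>The ramp and its increments\<close>

definition ramp :: "real \<Rightarrow> real" where
  "ramp \<tau> = max (- 1) (min 1 \<tau>)"

lemma abs_ramp_le: "\<bar>ramp \<tau>\<bar> \<le> 1"
  by (auto simp: ramp_def)

lemma ramp_bounds: "- 1 \<le> ramp \<tau>" "ramp \<tau> \<le> 1"
  by (auto simp: ramp_def)

lemma ramp_eq_one: "1 \<le> \<tau> \<Longrightarrow> ramp \<tau> = 1"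
  and ramp_eq_minus_one: "\<tau> \<le> - 1 \<Longrightarrow> ramp \<tau> = - 1"
  by (auto simp: ramp_def)

lemma ramp_minus: "ramp (- \<tau>) = - ramp \<tau>"
  by (auto simp: ramp_def)

lemma abs_ramp_diff_le: "\<bar>ramp a - ramp b\<bar> \<le> \<bar>a - b\<bar>"
  by (auto simp: ramp_def)

lemma continuous_on_ramp [continuous_intros]:
  "continuous_on A f \<Longrightarrow> continuous_on A (\<lambda>x. ramp (f x))"
  unfolding ramp_def by (intro continuous_intros)

text \<open>The scale depends on \<open>b\<close> alone, so it stays fixed when integrating over the
  other point. In the layer the ramp has slope \<open>1 / \<epsilon>\<close>. For
  \<open>b > \<epsilon>\<close> the ramp is 1 at \<open>b\<close>: it is also 1 at any
  \<open>a \<ge> b\<close>, lies above the line \<open>a / b\<close> for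
  \<open>0 \<le> a < b\<close>, and for \<open>a < 0\<close> the quotient is at least 1 while the
  increment is at most 2. Negative \<open>b\<close> follows by oddness.\<close>

lemma ramp_increment_bound:
  assumes "0 < \<epsilon>"
  shows "\<bar>ramp (a / \<epsilon>) - ramp (b / \<epsilon>)\<bar> \<le> 2 * min 1 (\<bar>a - b\<bar> / max \<epsilon> \<bar>b\<bar>)"
proof -
  have far: "\<bar>ramp (a / \<epsilon>) - ramp (b / \<epsilon>)\<bar> \<le> 2 * (\<bar>a - b\<bar> / b)" if "\<epsilon> < b" for a b
  proof -
    have b: "ramp (b / \<epsilon>) = 1" using that assms by (intro ramp_eq_one) (simp add: field_simps)
    consider "b \<le> a" | "0 \<le> a" "a < b" | "a < 0" by linarith
    then show ?thesis
    proof cases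
      case 1
      then have "ramp (a / \<epsilon>) = 1" using that assms by (intro ramp_eq_one) (simp add: field_simps)
      then show ?thesis using b that assms by simp
    next
      case 2
      have "a / b \<le> a / \<epsilon>" using 2 that assms by (intro divide_left_mono) auto
      moreover have "a / b \<le> 1" using 2 that assms by simp
      ultimately have "a / b \<le> ramp (a / \<epsilon>)" by (auto simp: ramp_def)
      then have "\<bar>ramp (a / \<epsilon>) - ramp (b / \<epsilon>)\<bar> \<le> 1 - a / b"
        using b ramp_bounds(2)[of "a / \<epsilon>"] by simp
      also have "\<dots> = \<bar>a - b\<bar> / b" using 2 that assms by (simp add: field_simps)
      also have "\<bar>a - b\<bar> / b \<le> 2 * (\<bar>a - b\<bar> / b)" using divide_nonneg_pos[of "\<bar>a - b\<bar>" b] that assms by linarith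
      finally show ?thesis .
    next
      case 3
      have "1 \<le> \<bar>a - b\<bar> / b" using 3 that assms by (simp add: field_simps)
      then show ?thesis using b ramp_bounds[of "a / \<epsilon>"] by simp
    qed
  qed
  have "\<bar>ramp (a / \<epsilon>) - ramp (b / \<epsilon>)\<bar> \<le> 2 * (\<bar>a - b\<bar> / max \<epsilon> \<bar>b\<bar>)"
  proof -
    consider "\<bar>b\<bar> \<le> \<epsilon>" | "\<epsilon> < b" | "\<epsilon> < - b" by linarith
    then show ?thesis
    proof cases
      case 1
      have "\<bar>ramp (a / \<epsilon>) - ramp (b / \<epsilon>)\<bar> \<le> \<bar>a / \<epsilon> - b / \<epsilon>\<bar>" by (rule abs_ramp_diff_le)
      also have "\<dots> = \<bar>a - b\<bar> / \<epsilon>" using assms by (simp add: abs_divide flip: diff_divide_distrib)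
      also have "\<dots> \<le> 2 * (\<bar>a - b\<bar> / \<epsilon>)"
        using divide_nonneg_pos[of "\<bar>a - b\<bar>" \<epsilon>] assms by linarith
      finally show ?thesis using 1 by (simp add: max_def)
    next
      case 2
      then show ?thesis using far[of b a] assms by (simp add: max_def)
    next
      case 3
      then show ?thesis using far[of "- b" "- a"] assms by (simp add: ramp_minus max_def abs_minus_commute)
    qed
  qed
  moreover have "\<bar>ramp (a / \<epsilon>) - ramp (b / \<epsilon>)\<bar> \<le> 2"
    using ramp_bounds[of "a / \<epsilon>"] ramp_bounds[of "b / \<epsilon>"] by simp
  ultimately show ?thesis by (simp add: min_def)
qed

section \<open>Energy of the ramp\<close>

lemma kernel_ramp_le:
  fixes x y :: "real ^ 'n"
  assumes "0 < \<epsilon>"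
  shows "kernel s (\<lambda>x. ramp ((x $ i - t) / \<epsilon>)) x y
    \<le> 4 * ((min 1 (norm (x - y) / max \<epsilon> \<bar>y $ i - t\<bar>))\<^sup>2 / norm (x - y) powr (real CARD('n) + 2 * s))"
proof -
  have "\<bar>ramp ((x $ i - t) / \<epsilon>) - ramp ((y $ i - t) / \<epsilon>)\<bar>
      \<le> 2 * min 1 (\<bar>(x $ i - t) - (y $ i - t)\<bar> / max \<epsilon> \<bar>y $ i - t\<bar>)"
    by (rule ramp_increment_bound[OF assms])
  also have "\<dots> \<le> 2 * min 1 (norm (x - y) / max \<epsilon> \<bar>y $ i - t\<bar>)"
    using assms component_le_norm_cart[of "x - y" i]
    by (intro mult_left_mono min.mono divide_right_mono) auto
  finally have "\<bar>ramp ((x $ i - t) / \<epsilon>) - ramp ((y $ i - t) / \<epsilon>)\<bar>\<^sup>2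
      \<le> (2 * min 1 (norm (x - y) / max \<epsilon> \<bar>y $ i - t\<bar>))\<^sup>2"
    by (intro power_mono) auto
  then show ?thesis
    unfolding kernel_def by (simp add: power_mult_distrib divide_right_mono)
qed

text \<open>Kinetic and potential parts are both bounded by multiples of the same weighted integral
  \<open>J\<close>, with the same power of \<open>\<epsilon>\<close> in front, so the sum
  factors.\<close>

lemma F_energy_ramp_le:
  fixes \<Omega> :: "(real ^ 'n) set"
  assumes "0 < \<epsilon>" "0 \<le> C" "0 \<le> B" "open \<Omega>"
    and W: "W 1 = 0" "W (- 1) = 0" "\<And>\<tau>. \<bar>\<tau>\<bar> \<le> 1 \<Longrightarrow> W \<tau> \<le> B"
    and C: "\<And>(y::real ^ 'n) \<rho>. 0 < \<rho> \<Longrightarrow>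
      (\<integral>\<^sup>+x. ennreal ((min 1 (norm (x - y) / \<rho>))\<^sup>2 / norm (x - y) powr (real CARD('n) + 2 * s)) \<partial>lborel)
      \<le> ennreal (C * \<rho> powr (- 2 * s))"
  shows "F_energy W s \<epsilon> (\<lambda>x. ramp ((x $ i - t) / \<epsilon>)) \<Omega>
    \<le> ennreal (kappa s \<epsilon> * \<epsilon> powr (2 * s)) * (ennreal (8 * C + B) *
        (\<integral>\<^sup>+y\<in>\<Omega>. ennreal (max \<epsilon> \<bar>y $ i - t\<bar> powr (- 2 * s)) \<partial>lborel))"
proof -
  define v where "v = (\<lambda>x::real ^ 'n. ramp ((x $ i - t) / \<epsilon>))"
  define w where "w y = max \<epsilon> \<bar>y $ i - t\<bar> powr (- 2 * s)" for y :: "real ^ 'n"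
  define J where "J = (\<integral>\<^sup>+y\<in>\<Omega>. ennreal (w y) \<partial>lborel)"
  have [measurable]: "\<Omega> \<in> sets borel" using \<open>open \<Omega>\<close> by simp
  have [measurable]: "w \<in> borel_measurable borel" unfolding w_def by measurable
  have inner: "(\<integral>\<^sup>+x\<in>A. ennreal (kernel s v x y) \<partial>lborel) \<le> ennreal (4 * C) * ennreal (w y)" for A y
  proof -
    let ?\<rho> = "max \<epsilon> \<bar>y $ i - t\<bar>"
    let ?k = "\<lambda>x. (min 1 (norm (x - y) / ?\<rho>))\<^sup>2 / norm (x - y) powr (real CARD('n) + 2 * s)"
    have "(\<integral>\<^sup>+x\<in>A. ennreal (kernel s v x y) \<partial>lborel) \<le> (\<integral>\<^sup>+x. ennreal (4 * ?k x) \<partial>lborel)"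
      unfolding v_def
      by (intro nn_integral_mono)
         (auto split: split_indicator intro!: ennreal_leI kernel_ramp_le[OF \<open>0 < \<epsilon>\<close>] simp del: times_divide_eq_right)
    also have "\<dots> = (\<integral>\<^sup>+x. ennreal 4 * ennreal (?k x) \<partial>lborel)"
      by (intro nn_integral_cong ennreal_mult) auto
    also have "\<dots> = ennreal 4 * (\<integral>\<^sup>+x. ennreal (?k x) \<partial>lborel)"
      by (intro nn_integral_cmult) measurable
    also have "\<dots> \<le> ennreal 4 * ennreal (C * ?\<rho> powr (- 2 * s))"
      using \<open>0 < \<epsilon>\<close> by (intro mult_left_mono C) auto
    also have "\<dots> = ennreal (4 * C) * ennreal (w y)"
      using \<open>0 \<le> C\<close> unfolding w_def 
      by (subst (1 2) ennreal_mult[symmetric]) (auto simp: mult.assoc)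
    finally show ?thesis .
  qed
  \<comment> \<open>The inner bound comes from all of space, so \<open>A\<close> may be either
    \<open>\<Omega>\<close> or its complement.\<close>
  have outer: "(\<integral>\<^sup>+y\<in>\<Omega>. (\<integral>\<^sup>+x\<in>A. ennreal (kernel s v x y) \<partial>lebesgue) \<partial>lebesgue) \<le> ennreal (4 * C) * J" for A
  proof -
    have "(\<integral>\<^sup>+y\<in>\<Omega>. (\<integral>\<^sup>+x\<in>A. ennreal (kernel s v x y) \<partial>lborel) \<partial>lborel)
        \<le> (\<integral>\<^sup>+y. ennreal (4 * C) * (ennreal (w y) * indicator \<Omega> y) \<partial>lborel)"
      using inner by (intro nn_integral_mono) (auto split: split_indicator)
    also have "\<dots> = ennreal (4 * C) * J"
      unfolding J_def by (intro nn_integral_cmult) measurable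
    finally show ?thesis by (simp add: nn_integral_completion)
  qed
  \<comment> \<open>The factor \<open>1 / 2\<close> is coarsened to 1, so the two double integrals
    together cost \<open>8 * C\<close>.\<close>
  have "K_energy s v \<Omega> \<le> 1 * (ennreal (4 * C) * J) + ennreal (4 * C) * J"
    unfolding K_energy_def by (intro add_mono mult_mono outer) (auto intro: divide_le_posI_ennreal)
  also have "\<dots> = ennreal (8 * C) * J"
    using \<open>0 \<le> C\<close> by (simp flip: distrib_right ennreal_plus)
  finally have K: "K_energy s v \<Omega> \<le> ennreal (8 * C) * J" .
  \<comment> \<open>In the layer \<open>\<epsilon> powr (2 * s) * w y\<close> equals 1 and
    \<open>B\<close> bounds \<open>W\<close>; outside it \<open>v\<close> sits at a zero of
    \<open>W\<close>.\<close>
  have well: "W (v y) \<le> B * \<epsilon> powr (2 * s) * w y" for y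
  proof (cases "\<bar>y $ i - t\<bar> \<le> \<epsilon>")
    case True
    then have "\<epsilon> powr (2 * s) * w y = 1"
      using \<open>0 < \<epsilon>\<close> by (simp add: w_def max_def flip: powr_add)
    then show ?thesis using W(3)[of "v y"] by (simp add: v_def abs_ramp_le mult.assoc)
  next
    case False
    then have "1 \<le> (y $ i - t) / \<epsilon> \<or> (y $ i - t) / \<epsilon> \<le> - 1"
      using \<open>0 < \<epsilon>\<close> by (auto simp: field_simps abs_le_iff)
    then have "v y = 1 \<or> v y = - 1"
      unfolding v_def using ramp_eq_one ramp_eq_minus_one by blast
    then show ?thesis using W \<open>0 \<le> B\<close> by (auto simp: w_def)
  qed
  have "(\<integral>\<^sup>+y\<in>\<Omega>. ennreal (W (v y)) \<partial>lborel)
      \<le> (\<integral>\<^sup>+y. ennreal (B * \<epsilon> powr (2 * s)) * (ennreal (w y) * indicator \<Omega> y) \<partial>lborel)"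
    using well \<open>0 \<le> B\<close>
    by (intro nn_integral_mono) (auto split: split_indicator simp flip: ennreal_mult' intro!: ennreal_leI)
  also have "\<dots> = ennreal (B * \<epsilon> powr (2 * s)) * J"
    unfolding J_def by (intro nn_integral_cmult) measurable
  finally have P: "(\<integral>\<^sup>+y\<in>\<Omega>. ennreal (W (v y)) \<partial>lebesgue) \<le> ennreal (B * \<epsilon> powr (2 * s)) * J"
    by (simp add: nn_integral_completion)
  have "F_energy W s \<epsilon> v \<Omega> \<le> ennreal (kappa s \<epsilon>) *
      (ennreal (\<epsilon> powr (2 * s)) * (ennreal (8 * C) * J) + ennreal (B * \<epsilon> powr (2 * s)) * J)"
    unfolding F_energy_def by (intro add_mono mult_left_mono K P) auto
  also have "\<dots> = ennreal (kappa s \<epsilon> * \<epsilon> powr (2 * s)) * (ennreal (8 * C + B) * J)"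
    using \<open>0 \<le> C\<close> \<open>0 \<le> B\<close> by (simp add: ennreal_mult'' ennreal_plus algebra_simps)
  finally show ?thesis unfolding v_def J_def w_def .
qed

section \<open>Admissibility of the ramp\<close>

text \<open>As \<open>t\<close> runs from \<open>- (R + 1)\<close> to \<open>R + 1\<close>, the ramp
  on \<open>\<Omega>\<close> passes from constantly 1 to constantly -1, since
  \<open>\<epsilon> \<le> 1\<close> keeps the layer off \<open>\<Omega>\<close> at both ends. The
  bound on \<open>t\<close> does not involve \<open>\<epsilon>\<close>, which keeps later constants
  uniform.\<close>

lemma ramp_translate_mass:
  fixes \<Omega> :: "(real ^ 'n) set"
  assumes "0 < \<epsilon>" "\<epsilon> \<le> 1" "0 \<le> R" "open \<Omega>" "bounded \<Omega>"
    and R: "\<And>x. x \<in> \<Omega> \<Longrightarrow> \<bar>x $ i\<bar> \<le> R"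
    and m: "\<bar>m\<bar> \<le> measure lebesgue \<Omega>"
  obtains t where "\<bar>t\<bar> \<le> R + 1" "(LINT x:\<Omega>|lebesgue. ramp ((x $ i - t) / \<epsilon>)) = m"
proof -
  define G where "G t = (LINT x:\<Omega>|lebesgue. ramp ((x $ i - t) / \<epsilon>))" for t
  have \<Omega>: "\<Omega> \<in> lmeasurable"
    using assms by (simp add: bounded_set_imp_lmeasurable lmeasurable_open)
  have "(\<lambda>x::real ^ 'n. ramp ((x $ i - t) / \<epsilon>)) \<in> borel_measurable borel" for t
    using \<open>0 < \<epsilon>\<close> by (intro borel_measurable_continuous_onI continuous_intros) auto
  then have meas: "(\<lambda>x::real ^ 'n. ramp ((x $ i - t) / \<epsilon>)) \<in> borel_measurable lebesgue" for t
    by (intro measurable_completion) simp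
  have ind: "indicator \<Omega> \<in> borel_measurable lebesgue"
    using \<Omega> by (intro borel_measurable_indicator) (auto simp: fmeasurable_def)
  \<comment> \<open>Dominated convergence along sequences; the indicator of the bounded set
    \<open>\<Omega>\<close> is an integrable majorant.\<close>
  have "isCont G t" for t
    unfolding continuous_at_sequentially
  proof (intro allI impI)
    fix X assume X: "X \<longlonglongrightarrow> t"
    show "(G \<circ> X) \<longlonglongrightarrow> G t"
      unfolding G_def set_lebesgue_integral_def comp_def
    proof (rule integral_dominated_convergence[where w = "indicator \<Omega>"])
      show "AE x in lebesgue. (\<lambda>k. indicator \<Omega> x *\<^sub>R ramp ((x $ i - X k) / \<epsilon>))
          \<longlonglongrightarrow> indicator \<Omega> x *\<^sub>R ramp ((x $ i - t) / \<epsilon>)"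
        unfolding ramp_def using X \<open>0 < \<epsilon>\<close> by (intro AE_I2 tendsto_intros) auto
      show "AE x in lebesgue. norm (indicator \<Omega> x *\<^sub>R ramp ((x $ i - X k) / \<epsilon>)) \<le> indicator \<Omega> x" for k
        using abs_ramp_le by (auto split: split_indicator)
      show "integrable lebesgue (indicat_real \<Omega>)"
        using \<Omega> by (simp add: lmeasurable_iff_integrable)
    qed (intro borel_measurable_scaleR ind meas)+
  qed
  moreover have "G (- (R + 1)) = measure lebesgue \<Omega>"
  proof -
    have "ramp ((x $ i - - (R + 1)) / \<epsilon>) = 1" if "x \<in> \<Omega>" for x
      using R[OF that] assms by (intro ramp_eq_one) (simp add: field_simps abs_le_iff)
    then have "G (- (R + 1)) = (LINT x:\<Omega>|lebesgue. 1)"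
      unfolding G_def using \<Omega> by (intro set_lebesgue_integral_cong) (auto simp: fmeasurable_def)
    then show ?thesis by (simp add: set_lebesgue_integral_def)
  qed
  moreover have "G (R + 1) = - measure lebesgue \<Omega>"
  proof -
    have "ramp ((x $ i - (R + 1)) / \<epsilon>) = - 1" if "x \<in> \<Omega>" for x
      using R[OF that] assms by (intro ramp_eq_minus_one) (simp add: field_simps abs_le_iff)
    then have "G (R + 1) = (LINT x:\<Omega>|lebesgue. - 1)"
      unfolding G_def using \<Omega> by (intro set_lebesgue_integral_cong) (auto simp: fmeasurable_def)
    then show ?thesis by (simp add: set_lebesgue_integral_def)
  qed
  ultimately have "\<exists>t. - (R + 1) \<le> t \<and> t \<le> R + 1 \<and> G t = m"
    using m \<open>0 \<le> R\<close> by (intro IVT2) auto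
  then obtain t where "- (R + 1) \<le> t" "t \<le> R + 1" "G t = m" by blast
  then show thesis by (intro that[of t]) (simp_all add: G_def abs_le_iff)
qed

text \<open>Local integrability comes from continuity, by enclosing a compact set in a box; the sup
  bound holds because the ramp stays in \<open>[-1, 1]\<close> and \<open>1 \<le> M\<close>.\<close>

lemma ramp_in_Z:
  fixes \<Omega> :: "(real ^ 'n) set"
  assumes "0 < \<epsilon>" "1 \<le> M" "open \<Omega>" "(LINT x:\<Omega>|lebesgue. ramp ((x $ i - t) / \<epsilon>)) = m"
  shows "(\<lambda>x. ramp ((x $ i - t) / \<epsilon>)) \<in> Z \<Omega> M m"
proof -
  define v where "v = (\<lambda>x::real ^ 'n. ramp ((x $ i - t) / \<epsilon>))"
  have cont: "continuous_on A v" for A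
    unfolding v_def using \<open>0 < \<epsilon>\<close> by (intro continuous_intros) auto
  have "v absolutely_integrable_on K" if "compact K" for K
  proof -
    obtain a b where "K \<subseteq> cbox a b"
      using bounded_subset_cbox_symmetric[OF compact_imp_bounded[OF \<open>compact K\<close>]] by metis
    moreover have "v absolutely_integrable_on cbox a b"
      by (rule absolutely_integrable_continuous[OF cont])
    moreover have "K \<in> sets lebesgue"
      using that by (simp add: compact_imp_closed sets_completionI_sets)
    ultimately show ?thesis by (meson set_integrable_subset)
  qed
  moreover have "Linf_norm \<Omega> v \<le> ennreal M"
    unfolding Linf_norm_def
  proof (rule esssup_I)
    have "v \<in> borel_measurable (lebesgue_on \<Omega>)"
      by (intro continuous_imp_measurable_on_sets_lebesgue cont) (use \<open>open \<Omega>\<close> in auto)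
    then show "(\<lambda>x. ennreal \<bar>v x\<bar>) \<in> borel_measurable (lebesgue_on \<Omega>)" by measurable
    show "AE x in lebesgue_on \<Omega>. ennreal \<bar>v x\<bar> \<le> ennreal M"
      unfolding v_def using \<open>1 \<le> M\<close> by (intro AE_I2 ennreal_leI order_trans[OF abs_ramp_le])
  qed
  ultimately show ?thesis
    using assms(4) unfolding Z_def L1_loc_def v_def by simp
qed

section \<open>Uniform bound by comparison with the ramp\<close>

theorem theorem2p11:
  fixes W :: "real \<Rightarrow> real" and \<Omega> :: "(real ^ 'n) set" and M m s :: real
    and \<epsilon> :: "nat \<Rightarrow> real" and u :: "nat \<Rightarrow> real ^ 'n \<Rightarrow> real"
  assumes "double_well W"
    and "open \<Omega>" and "bounded \<Omega>" and "lipschitz_boundary \<Omega>"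
    and "1 < M"
    and "- measure lebesgue \<Omega> \<le> m" and "m \<le> measure lebesgue \<Omega>"
    and "0 < s" and "s < 1"
    and "\<And>k. 0 < \<epsilon> k" and "\<And>k. \<epsilon> k < 1" and "\<epsilon> \<longlonglongrightarrow> 0"
    and "\<And>k. minimizer W s (\<epsilon> k) \<Omega> M m (u k)"
  shows "\<exists>C::real. 0 < C \<and> (\<forall>k. F_energy W s (\<epsilon> k) (u k) \<Omega> \<le> ennreal C)"
proof -
  obtain N where N: "\<epsilon> k < 1 / 2" if "N \<le> k" for k
    using order_tendstoD(2)[OF \<open>\<epsilon> \<longlonglongrightarrow> 0\<close>, of "1 / 2"] by (auto simp: eventually_sequentially)
  \<comment> \<open>The value \<open>1 / 2\<close> bounds the tail of the sequence and the maximum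
    takes care of the finitely many earlier terms, each below 1.\<close>
  define \<epsilon>0 where "\<epsilon>0 = Max (insert (1 / 2) (\<epsilon> ` {..<N}))"
  have "\<epsilon>0 < 1" unfolding \<epsilon>0_def using assms(11) by (subst Max_less_iff) auto
  have \<epsilon>0: "\<epsilon> k \<le> \<epsilon>0" for k
  proof (cases "k < N")
    case False
    then have "\<epsilon> k \<le> 1 / 2" using N[of k] by simp
    also have "\<dots> \<le> \<epsilon>0" unfolding \<epsilon>0_def by (intro Max_ge) auto
    finally show ?thesis .
  qed (auto simp: \<epsilon>0_def)
  obtain R where "0 \<le> R" and R: "\<And>x. x \<in> \<Omega> \<Longrightarrow> norm x \<le> R"
    using \<open>bounded \<Omega>\<close> by (metis bounded_pos less_imp_le)
  \<comment> \<open>Any coordinate direction will do.\<close>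
  define i :: 'n where "i = undefined"
  define e :: "real ^ 'n" where "e = axis i 1"
  have e: "e \<in> Basis" "x \<bullet> e = x $ i" for x
    by (auto simp: e_def Basis_vec_def inner_axis)
  \<comment> \<open>Half-side of the box around \<open>\<Omega>\<close> plus the largest translation
    of the ramp.\<close>
  define L where "L = R + (R + 1)"
  have "1 \<le> L" using \<open>0 \<le> R\<close> by (simp add: L_def)
  obtain C1 where "0 \<le> C1" and C1: "\<And>(y::real ^ 'n) \<rho>. 0 < \<rho> \<Longrightarrow>
      (\<integral>\<^sup>+x. ennreal ((min 1 (norm (x - y) / \<rho>))\<^sup>2 / norm (x - y) powr (real CARD('n) + 2 * s)) \<partial>lborel)
      \<le> ennreal (C1 * \<rho> powr (- 2 * s))"
    using nn_integral_truncated_kernel_bound[OF \<open>0 < s\<close> \<open>s < 1\<close>, where ?'a = "real ^ 'n"] by auto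
  obtain C2 where "0 \<le> C2" and C2: "\<And>\<epsilon>. 0 < \<epsilon> \<Longrightarrow> \<epsilon> \<le> \<epsilon>0 \<Longrightarrow>
      ennreal (kappa s \<epsilon> * \<epsilon> powr (2 * s)) *
        (\<integral>\<^sup>+\<tau>. ennreal (max \<epsilon> \<bar>\<tau>\<bar> powr (- 2 * s)) * indicator {- L..L} \<tau> \<partial>lborel) \<le> ennreal C2"
    using kappa_profile_integral_bound[OF \<open>0 < s\<close> \<open>s < 1\<close> \<open>\<epsilon>0 < 1\<close> \<open>1 \<le> L\<close>] by blast
  have W: "W 1 = 0" "W (- 1) = 0" "\<And>\<tau>. 0 \<le> W \<tau>" "continuous_on {- 1..1} W"
    using \<open>double_well W\<close> unfolding double_well_def C2_def
    by (auto intro: continuous_on_subset differentiable_imp_continuous_on)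
  \<comment> \<open>The maximum of \<open>W\<close> over the range of the ramp plays the role of
    \<open>B\<close>.\<close>
  obtain \<tau>0 where "\<forall>\<tau>\<in>{- 1..1}. W \<tau> \<le> W \<tau>0"
    using continuous_attains_sup[OF _ _ W(4)] by auto
  then have B: "W \<tau> \<le> W \<tau>0" if "\<bar>\<tau>\<bar> \<le> 1" for \<tau> using that by (auto simp: abs_le_iff)
  define C where "C = (8 * C1 + W \<tau>0) * ((2 * R) ^ (CARD('n) - 1) * C2)"
  have "0 \<le> C" using \<open>0 \<le> C1\<close> \<open>0 \<le> C2\<close> \<open>0 \<le> R\<close> W(3) by (simp add: C_def)
  have "F_energy W s (\<epsilon> k) (u k) \<Omega> \<le> ennreal C" for k
  proof -
    have \<epsilon>: "0 < \<epsilon> k" "\<epsilon> k \<le> 1" using assms(10,11) by (auto simp: less_imp_le)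
    have Ri: "\<bar>x $ i\<bar> \<le> R" if "x \<in> \<Omega>" for x
      using R[OF that] component_le_norm_cart[of x i] by linarith
    have "\<bar>m\<bar> \<le> measure lebesgue \<Omega>" using assms(6,7) by simp
    then obtain t where t: "\<bar>t\<bar> \<le> R + 1" "(LINT x:\<Omega>|lebesgue. ramp ((x $ i - t) / \<epsilon> k)) = m"
      using ramp_translate_mass[OF \<epsilon> \<open>0 \<le> R\<close> \<open>open \<Omega>\<close> \<open>bounded \<Omega>\<close> Ri] by blast
    let ?v = "\<lambda>x::real ^ 'n. ramp ((x $ i - t) / \<epsilon> k)"
    let ?w = "\<lambda>\<tau>. ennreal (max (\<epsilon> k) \<bar>\<tau>\<bar> powr (- 2 * s))"
    let ?\<kappa> = "ennreal (kappa s (\<epsilon> k) * \<epsilon> k powr (2 * s))"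
    have "?v \<in> Z \<Omega> M m"
      using \<epsilon>(1) \<open>1 < M\<close> \<open>open \<Omega>\<close> t(2) by (intro ramp_in_Z) auto
    then have "F_energy W s (\<epsilon> k) (u k) \<Omega> \<le> F_energy W s (\<epsilon> k) ?v \<Omega>"
      using assms(13)[of k] unfolding minimizer_def by blast
    also have "\<dots> \<le> ?\<kappa> * (ennreal (8 * C1 + W \<tau>0) * (\<integral>\<^sup>+y\<in>\<Omega>. ?w (y $ i - t) \<partial>lborel))"
      by (rule F_energy_ramp_le[OF \<epsilon>(1) \<open>0 \<le> C1\<close> W(3) \<open>open \<Omega>\<close> W(1,2) B C1])
    also have "(\<integral>\<^sup>+y\<in>\<Omega>. ?w (y $ i - t) \<partial>lborel)
        \<le> ennreal ((2 * R) ^ (CARD('n) - 1)) * (\<integral>\<^sup>+\<tau>. ?w \<tau> * indicator {- L..L} \<tau> \<partial>lborel)"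
    proof -
      have "\<bar>y \<bullet> b\<bar> \<le> R" if "y \<in> \<Omega>" "b \<in> Basis" for y b
        using R[OF that(1)] Basis_le_norm[OF that(2), of y] by linarith
      then show ?thesis
        using nn_integral_slab_le[OF e(1), of ?w R t "R + 1" \<Omega>] \<open>0 \<le> R\<close> t(1)
        unfolding e(2) L_def by simp
    qed
    \<comment> \<open>Reordering puts the prefactor next to the one-dimensional integral; only their
      product is bounded uniformly, by \<open>C2\<close>.\<close>
    also have "?\<kappa> * (ennreal (8 * C1 + W \<tau>0) * (ennreal ((2 * R) ^ (CARD('n) - 1)) *
          (\<integral>\<^sup>+\<tau>. ?w \<tau> * indicator {- L..L} \<tau> \<partial>lborel)))
        = ennreal (8 * C1 + W \<tau>0) * (ennreal ((2 * R) ^ (CARD('n) - 1)) *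
          (?\<kappa> * (\<integral>\<^sup>+\<tau>. ?w \<tau> * indicator {- L..L} \<tau> \<partial>lborel)))"
      by (simp only: mult_ac)
    also have "\<dots> \<le> ennreal (8 * C1 + W \<tau>0) * (ennreal ((2 * R) ^ (CARD('n) - 1)) * ennreal C2)"
      using \<epsilon>(1) \<epsilon>0 by (intro mult_left_mono C2) auto
    also have "\<dots> = ennreal C"
      using \<open>0 \<le> C1\<close> \<open>0 \<le> C2\<close> \<open>0 \<le> R\<close> W(3) unfolding C_def by (simp add: ennreal_mult)
    finally show ?thesis by (simp add: mult_left_mono)
  qed
  \<comment> \<open>\<open>C\<close> is only known to be nonnegative; adding 1 makes the constant
    positive.\<close>
  moreover have "ennreal C \<le> ennreal (C + 1)" by (intro ennreal_leI) simp
  ultimately have "F_energy W s (\<epsilon> k) (u k) \<Omega> \<le> ennreal (C + 1)" for k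
    by (rule order_trans)
  then show ?thesis
    using \<open>0 \<le> C\<close> by (intro exI[of _ "C + 1"]) (simp del: ennreal_plus)
qed

end
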